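(* Let $P$ be a finite poset and let $\mathcal{C}\subset \mathrm{MaxChain}(P)$ be a nonempty subset. Then $\mathrm{conv}(\mathcal{C})$ is not a face of the maximal chain polytope $\mathscr{M}(P)$ if and only if $\mathcal{C}$ has an incomplete guided crown structure.
   Context: Posets are finite; write $P=\{1,\dots,p\}$ for the underlying set of a poset with order relation $\le$. A chain is a subset in which any two elements are comparable; a maximal chain is a chain not contained in a larger chain; $\mathrm{MaxChain}(P)$ is the set of all maximal chains of $P$. Write $x\lessdot y$ if $y$ covers $x$, i.e. $x<y$ and there is no $z$ with $x<z<y$. Polytopes: for $Q\subset P$ let $e_Q=\sum_{x\in Q}e_x\in\mathbb{R}^p$, where $e_x$ is the standard unit vector. For a set $\mathcal{Q}$ of subsets of $P$, $\mathrm{conv}(\mathcal{Q})$ is the convex hull of $\{e_Q\mid Q\in\mathcal{Q}\}$. The maximal chain polytope is $\mathscr{M}(P)=\mathrm{conv}(\mathrm{MaxChain}(P))$. Faces of $\mathscr{M}(P)$ include $\mathscr{M}(P)$ itself. Intervals: for $Q\subset P$ and $x,y\in P$ put $(-\infty,x]_Q=\{z\in Q\mid z\le x\}$, $[x,\infty)_Q=\{z\in Q\mid z\ge x\}$, $(x,\infty)_Q=\{z\in Q\mid z>x\}$, $(x,y)_Q=\{z\in Q\mid x<z<y\}$. For $\mathcal{C}\subset\mathrm{MaxChain}(P)$ and $x,y\in P$ put $\mathcal{C}_{xy}=\{C\in\mathcal{C}\mid x,y\in C\}$. Guided crowns: for $\rho\ge 2$, a sequence $W=(\alpha_1,\beta_1,\dots,\alpha_\rho,\beta_\rho)$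 of elements of $P$ is a guided ($\rho$-)crown of $\mathcal{C}$ if (with index $0$ identified with $\rho$) $\alpha_i\lessdot\beta_i$ and $\alpha_i\lessdot\beta_{i-1}$ for all $i\in\{1,\dots,\rho\}$; $\alpha_i\ne\alpha_j$ and $\beta_i\neq\beta_j$ for all distinct $i,j$; and $\mathcal{C}_{\alpha_i\beta_i}\neq\emptyset$ for all $i$. It is complete if for every $i\in\{1,\dots,\rho\}$ and all $C_i\in\mathcal{C}_{\alpha_i\beta_i}$, $C_{i-1}\in\mathcal{C}_{\alpha_{i-1}\beta_{i-1}}$ one has $(-\infty,\alpha_i]_{C_i}\cup[\beta_{i-1},\infty)_{C_{i-1}}\in\mathcal{C}$; otherwise it is incomplete. Guided stars: a sequence $(\alpha_1,\beta_1,\alpha_2,\beta_2)$ of elements of $P$ is a guided star of $\mathcal{C}$ if $\alpha_1,\alpha_2$ are incomparable, $\beta_1,\beta_2$ are incomparable, $\alpha_1<\beta_1$, $\alpha_2<\beta_2$, and there exist $C_1\in\mathcal{C}_{\alpha_1\beta_1}$, $C_2\in\mathcal{C}_{\alpha_2\beta_2}$ with $(\alpha_1,\beta_1)_{C_1}\cap(\alpha_2,\beta_2)_{C_2}\neq\emptyset$. It is complete if for all $C_1\in\mathcal{C}_{\alpha_1\beta_1}$, $C_2\in\mathcal{C}_{\alpha_2\beta_2}$ with $(\alpha_1,\beta_1)_{C_1}\cap(\alpha_2,\beta_2)_{C_2}\ne\emptyset$ and every $\gamma$ in this intersection, both $(-\infty,\gamma]_{C_1}\cup(\gamma,\infty)_{C_2}$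 and $(-\infty,\gamma]_{C_2}\cup(\gamma,\infty)_{C_1}$ belong to $\mathcal{C}$; otherwise it is incomplete. $\mathcal{C}$ has a guided crown structure if it has at least one guided $\rho$-crown (for some $\rho\ge2$) or at least one guided star. A guided crown structure of $\mathcal{C}$ is complete if every guided crown and every guided star of $\mathcal{C}$ is complete; otherwise (some guided crown or guided star of $\mathcal{C}$ is incomplete) $\mathcal{C}$ has an incomplete guided crown structure. *)

theory Defs
  imports "HOL-Analysis.Analysis"
begin

text \<open>
  The finite poset $P$ is the universe of a type of sort \<open>{finite, order}\<close>, so that the
  ambient space $\mathbb{R}^p$ is \<open>real ^ 'a\<close>. The intervals $(-\infty,x]_Q$, $[x,\infty)_Q$,
  $(x,\infty)_Q$, $(x,y)_Q$ are written \<open>Q \<inter> {..x}\<close>, \<open>Q \<inter> {x..}\<close>, \<open>Q \<inter> {x<..}\<close>,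
  \<open>Q \<inter> {x<..<y}\<close>.
\<close>

definition covered_by :: "'a::order \<Rightarrow> 'a \<Rightarrow> bool"  (infix \<open>\<lessdot>\<close> 50)
  where "x \<lessdot> y \<longleftrightarrow> x < y \<and> \<not> (\<exists>z. x < z \<and> z < y)"

definition incomparable :: "'a::order \<Rightarrow> 'a \<Rightarrow> bool"
  where "incomparable x y \<longleftrightarrow> \<not> x \<le> y \<and> \<not> y \<le> x"

definition MaxChain :: "'a::order set set"
  where "MaxChain = {C. pred_on.maxchain UNIV (<) C}"

definition unit_sum :: "'a::finite set \<Rightarrow> real ^ 'a"
  where "unit_sum Q = (\<Sum>x\<in>Q. axis x 1)"

definition conv :: "'a::finite set set \<Rightarrow> (real ^ 'a) set"
  where "conv \<Q> = convex hull (unit_sum ` \<Q>)"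

definition max_chain_polytope :: "(real ^ 'a::{finite,order}) set"
  where "max_chain_polytope = conv MaxChain"

text \<open>The chains of $\mathcal{C}_{xy}$.\<close>

definition chains_through :: "'a set set \<Rightarrow> 'a \<Rightarrow> 'a \<Rightarrow> 'a set set"
  where "chains_through \<C> x y = {C \<in> \<C>. x \<in> C \<and> y \<in> C}"

text \<open>
  A sequence $(\alpha_1,\beta_1,\dots,\alpha_\rho,\beta_\rho)$ is given by two functions on the
  naturals, of which only the values on \<open>{1..\<rho>}\<close> are used; \<open>cyc_pred \<rho> i\<close> is the index
  $i - 1$, with $0$ identified with $\rho$.
\<close>

definition cyc_pred :: "nat \<Rightarrow> nat \<Rightarrow> nat"
  where "cyc_pred \<rho> i = (if i = 1 then \<rho> else i - 1)"

definition guided_crown ::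
  "'a::order set set \<Rightarrow> nat \<Rightarrow> (nat \<Rightarrow> 'a) \<Rightarrow> (nat \<Rightarrow> 'a) \<Rightarrow> bool"
  where "guided_crown \<C> \<rho> \<alpha> \<beta> \<longleftrightarrow>
    2 \<le> \<rho> \<and>
    (\<forall>i\<in>{1..\<rho>}. \<alpha> i \<lessdot> \<beta> i \<and> \<alpha> i \<lessdot> \<beta> (cyc_pred \<rho> i)) \<and>
    (\<forall>i\<in>{1..\<rho>}. \<forall>j\<in>{1..\<rho>}. i \<noteq> j \<longrightarrow> \<alpha> i \<noteq> \<alpha> j \<and> \<beta> i \<noteq> \<beta> j) \<and>
    (\<forall>i\<in>{1..\<rho>}. chains_through \<C> (\<alpha> i) (\<beta> i) \<noteq> {})"

definition crown_complete ::
  "'a::order set set \<Rightarrow> nat \<Rightarrow> (nat \<Rightarrow> 'a) \<Rightarrow> (nat \<Rightarrow> 'a) \<Rightarrow> bool"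
  where "crown_complete \<C> \<rho> \<alpha> \<beta> \<longleftrightarrow>
    (\<forall>i\<in>{1..\<rho>}.
      \<forall>C \<in> chains_through \<C> (\<alpha> i) (\<beta> i).
      \<forall>C' \<in> chains_through \<C> (\<alpha> (cyc_pred \<rho> i)) (\<beta> (cyc_pred \<rho> i)).
        (C \<inter> {..\<alpha> i}) \<union> (C' \<inter> {\<beta> (cyc_pred \<rho> i)..}) \<in> \<C>)"

definition guided_star ::
  "'a::order set set \<Rightarrow> 'a \<Rightarrow> 'a \<Rightarrow> 'a \<Rightarrow> 'a \<Rightarrow> bool"
  where "guided_star \<C> \<alpha>\<^sub>1 \<beta>\<^sub>1 \<alpha>\<^sub>2 \<beta>\<^sub>2 \<longleftrightarrow>
    incomparable \<alpha>\<^sub>1 \<alpha>\<^sub>2 \<and> incomparable \<beta>\<^sub>1 \<beta>\<^sub>2 \<and> \<alpha>\<^sub>1 < \<beta>\<^sub>1 \<and> \<alpha>\<^sub>2 < \<beta>\<^sub>2 \<and>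
    (\<exists>C\<^sub>1 \<in> chains_through \<C> \<alpha>\<^sub>1 \<beta>\<^sub>1. \<exists>C\<^sub>2 \<in> chains_through \<C> \<alpha>\<^sub>2 \<beta>\<^sub>2.
      (C\<^sub>1 \<inter> {\<alpha>\<^sub>1<..<\<beta>\<^sub>1}) \<inter> (C\<^sub>2 \<inter> {\<alpha>\<^sub>2<..<\<beta>\<^sub>2}) \<noteq> {})"

definition star_complete ::
  "'a::order set set \<Rightarrow> 'a \<Rightarrow> 'a \<Rightarrow> 'a \<Rightarrow> 'a \<Rightarrow> bool"
  where "star_complete \<C> \<alpha>\<^sub>1 \<beta>\<^sub>1 \<alpha>\<^sub>2 \<beta>\<^sub>2 \<longleftrightarrow>
    (\<forall>C\<^sub>1 \<in> chains_through \<C> \<alpha>\<^sub>1 \<beta>\<^sub>1. \<forall>C\<^sub>2 \<in> chains_through \<C> \<alpha>\<^sub>2 \<beta>\<^sub>2.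
      \<forall>\<gamma> \<in> (C\<^sub>1 \<inter> {\<alpha>\<^sub>1<..<\<beta>\<^sub>1}) \<inter> (C\<^sub>2 \<inter> {\<alpha>\<^sub>2<..<\<beta>\<^sub>2}).
        (C\<^sub>1 \<inter> {..\<gamma>}) \<union> (C\<^sub>2 \<inter> {\<gamma><..}) \<in> \<C> \<and>
        (C\<^sub>2 \<inter> {..\<gamma>}) \<union> (C\<^sub>1 \<inter> {\<gamma><..}) \<in> \<C>)"

definition has_guided_crown_structure :: "'a::order set set \<Rightarrow> bool"
  where "has_guided_crown_structure \<C> \<longleftrightarrow>
    (\<exists>\<rho> \<alpha> \<beta>. guided_crown \<C> \<rho> \<alpha> \<beta>) \<or> (\<exists>\<alpha>\<^sub>1 \<beta>\<^sub>1 \<alpha>\<^sub>2 \<beta>\<^sub>2. guided_star \<C> \<alpha>\<^sub>1 \<beta>\<^sub>1 \<alpha>\<^sub>2 \<beta>\<^sub>2)"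

definition has_incomplete_guided_crown_structure :: "'a::order set set \<Rightarrow> bool"
  where "has_incomplete_guided_crown_structure \<C> \<longleftrightarrow>
    has_guided_crown_structure \<C> \<and>
    ((\<exists>\<rho> \<alpha> \<beta>. guided_crown \<C> \<rho> \<alpha> \<beta> \<and> \<not> crown_complete \<C> \<rho> \<alpha> \<beta>) \<or>
     (\<exists>\<alpha>\<^sub>1 \<beta>\<^sub>1 \<alpha>\<^sub>2 \<beta>\<^sub>2. guided_star \<C> \<alpha>\<^sub>1 \<beta>\<^sub>1 \<alpha>\<^sub>2 \<beta>\<^sub>2 \<and> \<not> star_complete \<C> \<alpha>\<^sub>1 \<beta>\<^sub>1 \<alpha>\<^sub>2 \<beta>\<^sub>2))"

end

theory Submission
  imports Defs
begin

text \<open>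
  A point of the polytope is a convex combination of maximal chains, and its coordinate at \<open>v\<close> is
  the total weight of the chains through \<open>v\<close>. So $\mathrm{conv}(\mathcal{C})$ is a face exactly when
  no weighting supported on \<open>\<C>\<close> has the same coordinates as a weighting that gives positive
  weight to a maximal chain outside \<open>\<C>\<close>. Both directions are about such coincidences.

  If the set is a face, recombining chains of \<open>\<C>\<close> cannot leave \<open>\<C>\<close>: swapping the upper
  parts of two chains at a common element, or rerouting the chains of a crown along the cover
  relations $\alpha_i \lessdot \beta_{i-1}$, produces maximal chains with the same sum of
  indicator vectors, and \<open>face_of_chain_exchange\<close> puts each of them into \<open>\<C>\<close>.

  Conversely, let all stars and crowns be complete. Complete stars make \<open>\<C>\<close> closed under swapping
  at any common element (\<open>swap_in_family\<close>), so \<open>\<C>\<close> consists of all maximal chains whose elements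
  and cover relations are used by members of \<open>\<C>\<close> (\<open>chain_of_used_covers_in_family\<close>). Now let
  weightings \<open>l\<close> on \<open>\<C>\<close> and \<open>\<mu>\<close> on all maximal chains have equal coordinates, and suppose that a
  chain of positive weight under \<open>\<mu>\<close> uses a cover relation \<open>v \<lessdot> w\<close> that no member of \<open>\<C>\<close> uses.
  Regard both weightings as flows on the cover relations. Equal coordinates mean that both flows
  leave and enter every element in equal amounts, so the matrix of their difference has zero row and
  column sums. Its positive entry at \<open>(v, w)\<close> then lies on a simple cycle of alternately positive and
  negative entries (\<open>alternating_cycle\<close>). Negative entries are cover relations used by \<open>\<C>\<close>, so this
  cycle is a guided crown, and its completeness yields a member of \<open>\<C>\<close> that uses \<open>v \<lessdot> w\<close>:
  a contradiction (\<open>no_foreign_chain\<close>).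
\<close>

section \<open>Alternating cycles in matrices with vanishing row and column sums\<close>

text \<open>
  Think of a negative entry as a step from its row to its column and of a positive entry as a step
  back; the block \<open>A \<times> B\<close> is then closed under steps. Its total is at least \<open>0\<close> when summed by
  columns and at most \<open>0\<close> when summed by rows, so it vanishes. Hence the entries in the rows of
  \<open>A\<close> outside \<open>B\<close>, which are nonnegative, have total \<open>0\<close>.
\<close>

lemma block_closed_under_signs:
  fixes h :: "'a::finite \<Rightarrow> 'b::finite \<Rightarrow> real"
  assumes rows: "\<And>a. (\<Sum>b\<in>UNIV. h a b) = 0" and cols: "\<And>b. (\<Sum>a\<in>UNIV. h a b) = 0"
    and neg: "\<And>a b. a \<in> A \<Longrightarrow> h a b < 0 \<Longrightarrow> b \<in> B"
    and pos: "\<And>a b. b \<in> B \<Longrightarrow> 0 < h a b \<Longrightarrow> a \<in> A"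
    and ab: "a \<in> A" "b \<notin> B"
  shows "h a b = 0"
proof -
  have row_split: "(\<Sum>b\<in>-B. h a b) = - (\<Sum>b\<in>B. h a b)" for a
    using rows[of a] sum.union_disjoint[of B "-B" "h a"] by (simp add: Compl_partition)
  have col_split: "(\<Sum>a\<in>A. h a b) = - (\<Sum>a\<in>-A. h a b)" for b
    using cols[of b] sum.union_disjoint[of A "-A" "\<lambda>a. h a b"] by (simp add: Compl_partition)
  have nonneg: "0 \<le> h a b" if "a \<in> A" "b \<notin> B" for a b
    using neg[OF that(1), of b] that(2) by (meson not_less)
  have nonpos: "h a b \<le> 0" if "b \<in> B" "a \<in> - A" for a b
    using pos[OF that(1), of a] that(2) by (meson ComplD not_less)
  have "0 \<le> (\<Sum>a\<in>A. h a b)" if "b \<in> B" for b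
    using sum_nonpos[of "-A" "\<lambda>a. h a b"] nonpos[OF that] by (simp only: col_split neg_0_le_iff_le)
  then have "0 \<le> (\<Sum>b\<in>B. \<Sum>a\<in>A. h a b)"
    by (rule sum_nonneg)
  moreover have "(\<Sum>a\<in>A. \<Sum>b\<in>-B. h a b) = - (\<Sum>b\<in>B. \<Sum>a\<in>A. h a b)"
    unfolding row_split sum_negf by (simp only: sum.swap[of _ A B])
  moreover have row_nonneg: "0 \<le> (\<Sum>b\<in>-B. h a b)" if "a \<in> A" for a
    by (rule sum_nonneg) (simp add: nonneg that)
  then have "0 \<le> (\<Sum>a\<in>A. \<Sum>b\<in>-B. h a b)"
    by (rule sum_nonneg)
  ultimately have total: "(\<Sum>a\<in>A. \<Sum>b\<in>-B. h a b) = 0" by linarith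
  have "(\<Sum>b\<in>-B. h a b) = 0"
    by (rule sum_nonneg_0[OF _ row_nonneg total ab(1)]) simp_all
  then show ?thesis
    by (rule sum_nonneg_0[rotated 2]) (use ab in \<open>auto intro: nonneg\<close>)
qed

text \<open>
  Only \<open>a 0, \<dots>, a (n - 1)\<close> and \<open>b 0, \<dots>, b n\<close> matter: the walk starts and ends in a column and
  leaves each column through a positive entry and each row through a negative one.
\<close>

definition alternating_walk ::
  "('a \<Rightarrow> 'b \<Rightarrow> real) \<Rightarrow> nat \<Rightarrow> (nat \<Rightarrow> 'a) \<Rightarrow> (nat \<Rightarrow> 'b) \<Rightarrow> bool"
  where "alternating_walk h n a b \<longleftrightarrow> (\<forall>i<n. 0 < h (a i) (b i) \<and> h (a i) (b (Suc i)) < 0)"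

text \<open>
  The set of columns that walks through \<open>(a0, b0)\<close> reach is closed under further steps, so it must
  contain \<open>b0\<close>: otherwise the positive entry at \<open>(a0, b0)\<close> would have to vanish.
\<close>

lemma alternating_closed_walk:
  fixes h :: "'a::finite \<Rightarrow> 'b::finite \<Rightarrow> real"
  assumes rows: "\<And>a. (\<Sum>b\<in>UNIV. h a b) = 0" and cols: "\<And>b. (\<Sum>a\<in>UNIV. h a b) = 0"
    and pos: "0 < h a0 b0"
  obtains n a b where "1 \<le> n" "alternating_walk h n a b" "a 0 = a0" "b 0 = b0" "b n = b0"
proof -
  \<comment> \<open>Requiring at least one step keeps the trivial walk from putting \<open>b0\<close> into \<open>B\<close>.\<close>
  define B where "B = {y. \<exists>n a b. 1 \<le> n \<and> alternating_walk h n a b \<and> a 0 = a0 \<and> b 0 = b0 \<and> b n = y}"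
  define A where "A = insert a0 {x. \<exists>y\<in>B. 0 < h x y}"
  have neg: "y \<in> B" if "x \<in> A" "h x y < 0" for x y
  proof (cases "x = a0")
    case True
    have "alternating_walk h 1 (\<lambda>_. a0) (\<lambda>i. if i = 0 then b0 else y)"
      using True that pos by (simp add: alternating_walk_def)
    then show ?thesis unfolding B_def
      by (intro CollectI exI[of _ 1] exI[of _ "\<lambda>_. a0"] exI[of _ "\<lambda>i. if i = 0 then b0 else y"]) simp
  next
    case False
    with that(1) obtain y' where "y' \<in> B" "0 < h x y'" by (auto simp: A_def)
    then obtain n a b where w: "1 \<le> n" "alternating_walk h n a b" "a 0 = a0" "b 0 = b0" "0 < h x (b n)"
      unfolding B_def by blast
    have "alternating_walk h (Suc n) (a(n := x)) (b(Suc n := y))"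
      using w that(2) by (auto simp: alternating_walk_def less_Suc_eq)
    then show ?thesis unfolding B_def using w
      by (intro CollectI exI[of _ "Suc n"] exI[of _ "a(n := x)"] exI[of _ "b(Suc n := y)"]) simp
  qed
  have "b0 \<in> B"
  proof (rule ccontr)
    assume "b0 \<notin> B"
    have "h a0 b0 = 0"
    proof (rule block_closed_under_signs[where h=h and A=A and B=B])
      show "y \<in> B" if "x \<in> A" "h x y < 0" for x y using neg that .
      show "x \<in> A" if "y \<in> B" "0 < h x y" for x y using that by (auto simp: A_def)
      show "a0 \<in> A" by (simp add: A_def)
    qed (fact rows cols \<open>b0 \<notin> B\<close>)+
    with pos show False by simp
  qed
  then obtain n a b where "1 \<le> n" "alternating_walk h n a b" "a 0 = a0" "b 0 = b0" "b n = b0"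
    unfolding B_def by blast
  then show ?thesis by (rule that)
qed

text \<open>
  A shortest closed walk through \<open>(a0, b0)\<close> is simple, because the part between two visits of the
  same row or column could be cut out. The cut always leaves the entry at \<open>(a0, b0)\<close> in
  place as the start of the walk, so the cycle still passes through it.
\<close>

lemma alternating_cycle:
  fixes h :: "'a::finite \<Rightarrow> 'b::finite \<Rightarrow> real"
  assumes rows: "\<And>a. (\<Sum>b\<in>UNIV. h a b) = 0" and cols: "\<And>b. (\<Sum>a\<in>UNIV. h a b) = 0"
    and pos: "0 < h a0 b0"
  obtains n a b where "2 \<le> n" "alternating_walk h n a b" "a 0 = a0" "b 0 = b0" "b n = b0"
    "inj_on a {..<n}" "inj_on b {1..n}"
proof -
  define P where "P n \<longleftrightarrow> (\<exists>a b. 1 \<le> n \<and> alternating_walk h n a b \<and> a 0 = a0 \<and> b 0 = b0 \<and> b n = b0)" for n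
  have "\<exists>n. P n"
    using alternating_closed_walk[of h, OF rows cols pos] unfolding P_def by blast
  then obtain n where n: "P n" and least: "\<And>m. m < n \<Longrightarrow> \<not> P m"
    using exists_least_iff[of P] by blast
  from n obtain a b where w: "1 \<le> n" "alternating_walk h n a b" "a 0 = a0" "b 0 = b0" "b n = b0"
    by (auto simp: P_def)
  have step: "0 < h (a i) (b i)" "h (a i) (b (Suc i)) < 0" if "i < n" for i
    using w(2) that by (auto simp: alternating_walk_def)
  \<comment> \<open>For \<open>n = 1\<close> the entry at \<open>(a0, b0)\<close> would be both positive and negative.\<close>
  have n1: "n \<noteq> 1"
    using step[of 0] w by force
  have a_ne: "a i \<noteq> a j" if ij: "i < j" "j < n" for i j
  proof
    assume eq: "a i = a j"
    \<comment> \<open>Skip from step \<open>i\<close> to step \<open>j\<close>: enter the row as at \<open>i\<close> and leave it as at \<open>j\<close>.\<close>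
    define d where "d = j - i"
    define a' where "a' k = (if k \<le> i then a k else a (k + d))" for k
    define b' where "b' k = (if k \<le> i then b k else b (k + d))" for k
    have "alternating_walk h (n - d) a' b'"
      unfolding alternating_walk_def
    proof (intro allI impI)
      fix k assume k: "k < n - d"
      have jd: "i + d = j" using ij by (simp add: d_def)
      consider "k < i" | "k = i" | "i < k" by linarith
      then show "0 < h (a' k) (b' k) \<and> h (a' k) (b' (Suc k)) < 0"
      proof cases
        case 1
        with ij step[of k] show ?thesis by (simp add: a'_def b'_def)
      next
        case 2
        with ij step[of i] step[of j] eq jd show ?thesis by (simp add: a'_def b'_def)
      next
        case 3
        with k step[of "k + d"] show ?thesis by (simp add: a'_def b'_def)
      qed
    qed
    moreover have "b' (n - d) = b0"
      using w ij by (simp add: b'_def d_def)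
    moreover have "a' 0 = a0" "b' 0 = b0" "1 \<le> n - d"
      using w ij by (simp_all add: a'_def b'_def d_def)
    ultimately have "P (n - d)" unfolding P_def by blast
    moreover have "n - d < n" using ij by (auto simp: d_def)
    ultimately show False using least by blast
  qed
  have b_ne: "b i \<noteq> b j" if ij: "1 \<le> i" "i < j" "j \<le> n" for i j
  proof
    assume eq: "b i = b j"
    \<comment> \<open>Here the row at \<open>i\<close> is skipped too, as column \<open>b i\<close> is left through row \<open>a j\<close>.\<close>
    define d where "d = j - i"
    define a' where "a' k = (if k < i then a k else a (k + d))" for k
    define b' where "b' k = (if k \<le> i then b k else b (k + d))" for k
    have "alternating_walk h (n - d) a' b'"
      unfolding alternating_walk_def
    proof (intro allI impI)
      fix k assume k: "k < n - d"
      have jd: "i + d = j" using ij by (simp add: d_def)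
      consider "k < i" | "k = i" | "i < k" by linarith
      then show "0 < h (a' k) (b' k) \<and> h (a' k) (b' (Suc k)) < 0"
      proof cases
        case 1
        with ij step[of k] show ?thesis by (simp add: a'_def b'_def)
      next
        case 2
        have "j < n" using k 2 jd by simp
        with 2 step[of j] eq jd show ?thesis by (simp add: a'_def b'_def)
      next
        case 3
        with k step[of "k + d"] show ?thesis by (simp add: a'_def b'_def)
      qed
    qed
    moreover have "b' (n - d) = b0"
      using w ij eq by (cases "j = n") (auto simp: b'_def d_def)
    moreover have "a' 0 = a0" "b' 0 = b0" "1 \<le> n - d"
      using w ij by (simp_all add: a'_def b'_def d_def)
    ultimately have "P (n - d)" unfolding P_def by blast
    moreover have "n - d < n" using ij by (auto simp: d_def)
    ultimately show False using least by blast
  qed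
  have inj_a: "inj_on a {..<n}"
  proof (rule inj_onI, rule ccontr)
    fix i j assume "i \<in> {..<n}" "j \<in> {..<n}" "a i = a j" "i \<noteq> j"
    then show False using a_ne[of i j] a_ne[of j i] by (auto simp: neq_iff)
  qed
  have inj_b: "inj_on b {1..n}"
  proof (rule inj_onI, rule ccontr)
    fix i j assume "i \<in> {1..n}" "j \<in> {1..n}" "b i = b j" "i \<noteq> j"
    then show False using b_ne[of i j] b_ne[of j i] by (auto simp: neq_iff)
  qed
  have two_le: "2 \<le> n" using n1 w(1) by simp
  show ?thesis
    by (rule that[OF two_le w(2) w(3) w(4) w(5) inj_a inj_b])
qed

section \<open>Maximal chains and recombination\<close>

lemma MaxChain_iff:
  "C \<in> MaxChain \<longleftrightarrow>
    (\<forall>x\<in>C. \<forall>y\<in>C. x \<le> y \<or> y \<le> x) \<and> (\<forall>z. (\<forall>x\<in>C. x \<le> z \<or> z \<le> x) \<longrightarrow> z \<in> C)"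
  (is "_ \<longleftrightarrow> ?chain C \<and> ?max")
proof -
  have chain: "pred_on.chain UNIV (<) S \<longleftrightarrow> ?chain S" for S :: "'a set"
    by (auto simp: pred_on.chain_def le_less)
  have "(\<nexists>S. ?chain S \<and> C \<subset> S) \<longleftrightarrow> ?max" if "?chain C"
  proof (intro iffI allI impI)
    fix z assume "\<nexists>S. ?chain S \<and> C \<subset> S" "\<forall>x\<in>C. x \<le> z \<or> z \<le> x"
    moreover from this that have "?chain (insert z C)" by blast
    ultimately show "z \<in> C" by blast
  next
    assume ?max
    show "\<nexists>S. ?chain S \<and> C \<subset> S"
    proof
      assume "\<exists>S. ?chain S \<and> C \<subset> S"
      then obtain S z where "?chain S" "C \<subset> S" "z \<in> S" "z \<notin> C" by blast
      then have "\<forall>x\<in>C. x \<le> z \<or> z \<le> x" by blast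
      with \<open>?max\<close> \<open>z \<notin> C\<close> show False by blast
    qed
  qed
  then show ?thesis
    by (auto simp: MaxChain_def pred_on.maxchain_def chain)
qed

lemma MaxChain_chain: "C \<in> MaxChain \<Longrightarrow> x \<in> C \<Longrightarrow> y \<in> C \<Longrightarrow> x \<le> y \<or> y \<le> x"
  by (simp add: MaxChain_iff)

lemma MaxChain_max: "C \<in> MaxChain \<Longrightarrow> (\<And>x. x \<in> C \<Longrightarrow> x \<le> z \<or> z \<le> x) \<Longrightarrow> z \<in> C"
  by (simp add: MaxChain_iff)

lemma MaxChain_subset_eq:
  assumes "C \<in> MaxChain" "D \<in> MaxChain" "C \<subseteq> D"
  shows "C = D"
  using assms by (meson MaxChain_chain MaxChain_max subset_antisym subset_iff)

text \<open>
  This covers both kinds of recombination: \<open>\<alpha> = \<beta>\<close> is the swap at a common element of a star and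
  \<open>\<alpha> \<lessdot> \<beta>\<close> the rerouting in a crown. The result is maximal because nothing lies strictly between
  \<open>\<alpha>\<close> and \<open>\<beta>\<close>, while an element below \<open>\<alpha>\<close> that is comparable to the lower part is comparable to
  all of \<open>C\<close>, and dually for \<open>D\<close>.
\<close>

lemma MaxChain_glue:
  assumes C: "C \<in> MaxChain" "\<alpha> \<in> C" and D: "D \<in> MaxChain" "\<beta> \<in> D"
    and link: "\<alpha> = \<beta> \<or> \<alpha> \<lessdot> \<beta>"
  shows "(C \<inter> {..\<alpha>}) \<union> (D \<inter> {\<beta>..}) \<in> MaxChain" (is "?E \<in> _")
proof -
  have le: "\<alpha> \<le> \<beta>" using link by (auto simp: covered_by_def)
  have "x \<le> y \<or> y \<le> x" if "x \<in> ?E" "y \<in> ?E" for x y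
  proof -
    have across: "u \<le> w" if "u \<le> \<alpha>" "\<beta> \<le> w" for u w
      using that le by (blast intro: order_trans)
    show ?thesis
      using that across[of x y] across[of y x] MaxChain_chain[OF C(1), of x y] MaxChain_chain[OF D(1), of x y]
      by auto
  qed
  moreover have "z \<in> ?E" if z: "\<forall>x\<in>?E. x \<le> z \<or> z \<le> x" for z
  proof -
    have "\<alpha> \<in> ?E" "\<beta> \<in> ?E" using C D by auto
    then have "z \<le> \<alpha> \<or> \<beta> \<le> z"
      using z link by (metis covered_by_def order_less_le)
    then show ?thesis
    proof
      assume "z \<le> \<alpha>"
      have "z \<in> C"
      proof (rule MaxChain_max[OF C(1)])
        fix x assume "x \<in> C"
        then show "x \<le> z \<or> z \<le> x"
          using z \<open>z \<le> \<alpha>\<close> MaxChain_chain[OF C(1) C(2), of x] order_trans[of z \<alpha> x] by auto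
      qed
      with \<open>z \<le> \<alpha>\<close> show ?thesis by simp
    next
      assume "\<beta> \<le> z"
      have "z \<in> D"
      proof (rule MaxChain_max[OF D(1)])
        fix x assume "x \<in> D"
        then show "x \<le> z \<or> z \<le> x"
          using z \<open>\<beta> \<le> z\<close> MaxChain_chain[OF D(1) D(2), of x] order_trans[of x \<beta> z] by auto
      qed
      with \<open>\<beta> \<le> z\<close> show ?thesis by simp
    qed
  qed
  ultimately show ?thesis by (simp add: MaxChain_iff)
qed

lemma MaxChain_swap:
  assumes "C \<in> MaxChain" "D \<in> MaxChain" "\<gamma> \<in> C" "\<gamma> \<in> D"
  shows "(C \<inter> {..\<gamma>}) \<union> (D \<inter> {\<gamma><..}) \<in> MaxChain"
proof -
  have "(C \<inter> {..\<gamma>}) \<union> (D \<inter> {\<gamma><..}) = (C \<inter> {..\<gamma>}) \<union> (D \<inter> {\<gamma>..})"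
    using assms by (auto simp: le_less)
  then show ?thesis using MaxChain_glue[of C \<gamma> D \<gamma>] assms by simp
qed

lemma MaxChain_upper_cover_unique:
  assumes "D \<in> MaxChain" "v \<lessdot> w" "v \<lessdot> w'" "w \<in> D" "w' \<in> D"
  shows "w = w'"
  using assms MaxChain_chain[of D w w'] by (metis covered_by_def order_le_less)

lemma MaxChain_lower_cover_unique:
  assumes "D \<in> MaxChain" "w \<lessdot> v" "w' \<lessdot> v" "w \<in> D" "w' \<in> D"
  shows "w = w'"
  using assms MaxChain_chain[of D w w'] by (metis covered_by_def order_le_less)

lemma MaxChain_upper_cover_exists:
  fixes D :: "'a::{finite,order} set"
  assumes D: "D \<in> MaxChain" "v \<in> D" and "v < u"
  obtains w where "w \<in> D" "v \<lessdot> w"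
proof -
  let ?S = "D \<inter> {v<..}"
  have "?S \<noteq> {}"
  proof
    assume "?S = {}"
    then have "x \<le> v" if "x \<in> D" for x
      using that MaxChain_chain[OF D(1) that D(2)] by (auto simp: le_less)
    then have "u \<in> D" using \<open>v < u\<close> by (intro MaxChain_max[OF D(1)]) (meson less_imp_le order_trans)
    with \<open>?S = {}\<close> \<open>v < u\<close> show False by auto
  qed
  then obtain w where w: "w \<in> ?S" and min: "\<And>x. x \<in> ?S \<Longrightarrow> x \<le> w \<Longrightarrow> w = x"
    using finite_has_minimal[of ?S] by auto
  have above: "w \<le> x" if "x \<in> D" "v < x" for x
    using that w min[of x] MaxChain_chain[OF D(1), of w x] by auto
  have "\<not> (v < z \<and> z < w)" for z
  proof
    assume z: "v < z \<and> z < w"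
    have "x \<le> z \<or> z \<le> x" if xD: "x \<in> D" for x
    proof -
      consider "x \<le> v" | "v < x" using MaxChain_chain[OF D(1) xD D(2)] by (auto simp: le_less)
      then show ?thesis
        by cases (use z above[OF xD] order_trans[of x v z] order_trans[of z w x] in auto)
    qed
    then have "z \<in> D" by (rule MaxChain_max[OF D(1)])
    with above[of z] z show False by auto
  qed
  with w that[of w] show ?thesis by (auto simp: covered_by_def)
qed

lemma MaxChain_lower_cover_exists:
  fixes D :: "'a::{finite,order} set"
  assumes D: "D \<in> MaxChain" "v \<in> D" and "u < v"
  obtains w where "w \<in> D" "w \<lessdot> v"
proof -
  let ?S = "D \<inter> {..<v}"
  have "?S \<noteq> {}"
  proof
    assume "?S = {}"
    then have "v \<le> x" if "x \<in> D" for x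
      using that MaxChain_chain[OF D(1) that D(2)] by (auto simp: le_less)
    then have "u \<in> D" using \<open>u < v\<close> by (intro MaxChain_max[OF D(1)]) (meson less_imp_le order_trans)
    with \<open>?S = {}\<close> \<open>u < v\<close> show False by auto
  qed
  then obtain w where w: "w \<in> ?S" and max: "\<And>x. x \<in> ?S \<Longrightarrow> w \<le> x \<Longrightarrow> w = x"
    using finite_has_maximal[of ?S] by auto
  have below: "x \<le> w" if "x \<in> D" "x < v" for x
    using that w max[of x] MaxChain_chain[OF D(1), of w x] by auto
  have "\<not> (w < z \<and> z < v)" for z
  proof
    assume z: "w < z \<and> z < v"
    have "x \<le> z \<or> z \<le> x" if xD: "x \<in> D" for x
    proof -
      consider "v \<le> x" | "x < v" using MaxChain_chain[OF D(1) xD D(2)] by (auto simp: le_less)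
      then show ?thesis
        by cases (use z below[OF xD] order_trans[of z v x] order_trans[of x w z] in auto)
    qed
    then have "z \<in> D" by (rule MaxChain_max[OF D(1)])
    with below[of z] z show False by auto
  qed
  with w that[of w] show ?thesis by (auto simp: covered_by_def)
qed

text \<open>
  The count depends on \<open>v\<close> alone and not on the chain. This is what makes the amount of flow through
  an element determine the amount that leaves it, and dually the amount that enters it.
\<close>

lemma card_upper_covers_in_MaxChain:
  fixes D :: "'a::{finite,order} set"
  assumes D: "D \<in> MaxChain" "v \<in> D"
  shows "card {w \<in> D. v \<lessdot> w} = of_bool (\<exists>u. v < u)"
proof (cases "\<exists>u. v < u")
  case True
  then obtain w where "w \<in> D" "v \<lessdot> w"
    using MaxChain_upper_cover_exists[OF D] by blast
  then have "{w \<in> D. v \<lessdot> w} = {w}"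
    using MaxChain_upper_cover_unique[OF D(1)] by blast
  with True show ?thesis by simp
next
  case False
  then show ?thesis by (simp add: covered_by_def)
qed

lemma card_lower_covers_in_MaxChain:
  fixes D :: "'a::{finite,order} set"
  assumes D: "D \<in> MaxChain" "v \<in> D"
  shows "card {w \<in> D. w \<lessdot> v} = of_bool (\<exists>u. u < v)"
proof (cases "\<exists>u. u < v")
  case True
  then obtain w where "w \<in> D" "w \<lessdot> v"
    using MaxChain_lower_cover_exists[OF D] by blast
  then have "{w \<in> D. w \<lessdot> v} = {w}"
    using MaxChain_lower_cover_unique[OF D(1)] by blast
  with True show ?thesis by simp
next
  case False
  then show ?thesis by (simp add: covered_by_def)
qed

section \<open>Complete stars: a family determined by its cover relations\<close>

text \<open>
  If the swapped chain equals neither \<open>C\<close> nor \<open>D\<close>, the two chains differ both below and above \<open>\<gamma>\<close>.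
  By maximality, an element of one chain that is missing from the other is incomparable to some
  element of that other chain, necessarily on the same side of \<open>\<gamma>\<close>. The four elements found in this
  way form a guided star around \<open>\<gamma>\<close>.
\<close>

lemma swap_in_family:
  fixes \<C> :: "'a::{finite,order} set set"
  assumes sub: "\<C> \<subseteq> MaxChain"
    and stars: "\<And>\<alpha>\<^sub>1 \<beta>\<^sub>1 \<alpha>\<^sub>2 \<beta>\<^sub>2. guided_star \<C> \<alpha>\<^sub>1 \<beta>\<^sub>1 \<alpha>\<^sub>2 \<beta>\<^sub>2 \<Longrightarrow> star_complete \<C> \<alpha>\<^sub>1 \<beta>\<^sub>1 \<alpha>\<^sub>2 \<beta>\<^sub>2"
    and C: "C \<in> \<C>" "\<gamma> \<in> C" and D: "D \<in> \<C>" "\<gamma> \<in> D"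
  shows "(C \<inter> {..\<gamma>}) \<union> (D \<inter> {\<gamma><..}) \<in> \<C>" (is "?E \<in> _")
proof -
  have mc: "C \<in> MaxChain" "D \<in> MaxChain" using sub C D by auto
  have E: "?E \<in> MaxChain" using MaxChain_swap mc C D by blast
  consider "?E = C" | "?E = D" | "\<not> ?E \<subseteq> C" "\<not> ?E \<subseteq> D"
    using MaxChain_subset_eq E mc by blast
  then show ?thesis
  proof cases
    case 1
    with C(1) show ?thesis by (simp only:)
  next
    case 2
    with D(1) show ?thesis by (simp only:)
  next
    case 3
    then obtain \<beta>2 \<alpha>1 where b2: "\<beta>2 \<in> D" "\<gamma> < \<beta>2" "\<beta>2 \<notin> C"
      and a1: "\<alpha>1 \<in> C" "\<alpha>1 \<le> \<gamma>" "\<alpha>1 \<notin> D"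
      by auto
    obtain \<beta>1 where b1: "\<beta>1 \<in> C" "incomparable \<beta>1 \<beta>2"
      using b2(3) MaxChain_max[OF mc(1), of \<beta>2] by (auto simp: incomparable_def)
    obtain \<alpha>2 where a2: "\<alpha>2 \<in> D" "incomparable \<alpha>1 \<alpha>2"
      using a1(3) MaxChain_max[OF mc(2), of \<alpha>1] by (auto simp: incomparable_def)
    have "\<gamma> < \<beta>1"
      using MaxChain_chain[OF mc(1) C(2) b1(1)] b1(2) b2(2)
      by (metis incomparable_def less_imp_le order_le_less order_trans)
    moreover have "\<alpha>2 < \<gamma>"
      using MaxChain_chain[OF mc(2) D(2) a2(1)] a2(2) a1(2)
      by (metis incomparable_def order_le_less order_trans)
    moreover have "\<alpha>1 < \<gamma>" using a1 D(2) by (auto simp: le_less)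
    ultimately have \<gamma>: "\<gamma> \<in> (C \<inter> {\<alpha>1<..<\<beta>1}) \<inter> (D \<inter> {\<alpha>2<..<\<beta>2})"
      and lt: "\<alpha>1 < \<beta>1" "\<alpha>2 < \<beta>2" using C D b2(2) by auto
    have thr: "C \<in> chains_through \<C> \<alpha>1 \<beta>1" "D \<in> chains_through \<C> \<alpha>2 \<beta>2"
      using C D a1 a2 b1 b2 by (auto simp: chains_through_def)
    have "guided_star \<C> \<alpha>1 \<beta>1 \<alpha>2 \<beta>2"
      unfolding guided_star_def using a2(2) b1(2) lt thr \<gamma> by blast
    then have "star_complete \<C> \<alpha>1 \<beta>1 \<alpha>2 \<beta>2" by (rule stars)
    with thr \<gamma> show ?thesis unfolding star_complete_def by blast
  qed
qed

text \<open>
  Walking up \<open>D\<close>, swap at each element from a member of \<open>\<C>\<close> that contains \<open>D\<close> so far to one that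
  uses the next cover relation of \<open>D\<close>. Elements need a hypothesis of their own for the start of the
  walk, where no cover relation has been used yet.
\<close>

lemma chain_of_used_covers_in_family:
  fixes \<C> :: "'a::{finite,order} set set"
  assumes sub: "\<C> \<subseteq> MaxChain"
    and swap: "\<And>C D \<gamma>. C \<in> \<C> \<Longrightarrow> \<gamma> \<in> C \<Longrightarrow> D \<in> \<C> \<Longrightarrow> \<gamma> \<in> D \<Longrightarrow> (C \<inter> {..\<gamma>}) \<union> (D \<inter> {\<gamma><..}) \<in> \<C>"
    and D: "D \<in> MaxChain" "D \<noteq> {}"
    and vertices: "\<And>v. v \<in> D \<Longrightarrow> \<exists>C\<in>\<C>. v \<in> C"
    and covers: "\<And>v w. v \<in> D \<Longrightarrow> w \<in> D \<Longrightarrow> v \<lessdot> w \<Longrightarrow> chains_through \<C> v w \<noteq> {}"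
  shows "D \<in> \<C>"
proof -
  have prefix: "\<exists>C\<in>\<C>. d \<in> C \<and> D \<inter> {..d} \<subseteq> C" if "d \<in> D" for d
    using that
  proof (induction "card {..d}" arbitrary: d rule: less_induct)
    case less
    show ?case
    proof (cases "\<exists>u. u < d")
      case True
      then obtain c where c: "c \<in> D" "c \<lessdot> d"
        using MaxChain_lower_cover_exists[OF D(1) less.prems] by blast
      then have "c < d" by (simp add: covered_by_def)
      then have "card {..c} < card {..d}" by (intro psubset_card_mono) auto
      then obtain C where C: "C \<in> \<C>" "c \<in> C" "D \<inter> {..c} \<subseteq> C"
        using less.hyps c by blast
      obtain C' where C': "C' \<in> \<C>" "c \<in> C'" "d \<in> C'"
        using covers[OF c(1) less.prems c(2)] by (auto simp: chains_through_def)
      let ?E = "(C \<inter> {..c}) \<union> (C' \<inter> {c<..})"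
      have "D \<inter> {..d} \<subseteq> ?E"
      proof
        fix x assume x: "x \<in> D \<inter> {..d}"
        then have "x \<le> c \<or> x = d"
          using c MaxChain_chain[OF D(1), of x c] by (auto simp: covered_by_def le_less)
        then show "x \<in> ?E" using x C C' \<open>c < d\<close> by auto
      qed
      moreover have "?E \<in> \<C>" using swap C C' by auto
      moreover have "d \<in> ?E" using C' \<open>c < d\<close> by auto
      ultimately show ?thesis by (intro bexI[of _ ?E] conjI)
    next
      case False
      then have "D \<inter> {..d} \<subseteq> {d}" by (auto simp: le_less)
      with vertices[OF less.prems] show ?thesis by blast
    qed
  qed
  obtain m where m: "m \<in> D" "\<And>x. x \<in> D \<Longrightarrow> m \<le> x \<Longrightarrow> m = x"
    using finite_has_maximal[of D] D(2) by auto
  have "x \<le> m" if "x \<in> D" for x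
    using MaxChain_chain[OF D(1) m(1) that] m(2)[OF that] by auto
  then have "D \<inter> {..m} = D" by auto
  then obtain C where "C \<in> \<C>" "D \<subseteq> C" using prefix[OF m(1)] by auto
  then show ?thesis using MaxChain_subset_eq[OF D(1)] sub by blast
qed

section \<open>Weighted chains as flows\<close>

definition coverage :: "('a set \<Rightarrow> real) \<Rightarrow> 'a \<Rightarrow> real"
  where "coverage \<mu> v = (\<Sum>D | v \<in> D. \<mu> D)"

definition cover_flow :: "('a::order set \<Rightarrow> real) \<Rightarrow> 'a \<Rightarrow> 'a \<Rightarrow> real"
  where "cover_flow \<mu> v w = (if v \<lessdot> w then \<Sum>D | v \<in> D \<and> w \<in> D. \<mu> D else 0)"

lemma cover_flow_row_sum:
  fixes \<mu> :: "'a::{finite,order} set \<Rightarrow> real"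
  shows "(\<Sum>w\<in>UNIV. cover_flow \<mu> v w) = (\<Sum>D | v \<in> D. \<mu> D * card {w \<in> D. v \<lessdot> w})"
proof -
  have "cover_flow \<mu> v w = (\<Sum>D | v \<in> D. \<mu> D * of_bool (w \<in> D \<and> v \<lessdot> w))" for w
    unfolding cover_flow_def by (auto intro!: sum.mono_neutral_cong_left)
  then have "(\<Sum>w\<in>UNIV. cover_flow \<mu> v w)
      = (\<Sum>D | v \<in> D. \<Sum>w\<in>UNIV. \<mu> D * of_bool (w \<in> D \<and> v \<lessdot> w))"
    by (simp only:) (rule sum.swap)
  then show ?thesis by (simp flip: sum_distrib_left)
qed

lemma cover_flow_column_sum:
  fixes \<mu> :: "'a::{finite,order} set \<Rightarrow> real"
  shows "(\<Sum>w\<in>UNIV. cover_flow \<mu> w v) = (\<Sum>D | v \<in> D. \<mu> D * card {w \<in> D. w \<lessdot> v})"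
proof -
  have "cover_flow \<mu> w v = (\<Sum>D | v \<in> D. \<mu> D * of_bool (w \<in> D \<and> w \<lessdot> v))" for w
    unfolding cover_flow_def by (auto intro!: sum.mono_neutral_cong_left)
  then have "(\<Sum>w\<in>UNIV. cover_flow \<mu> w v)
      = (\<Sum>D | v \<in> D. \<Sum>w\<in>UNIV. \<mu> D * of_bool (w \<in> D \<and> w \<lessdot> v))"
    by (simp only:) (rule sum.swap)
  then show ?thesis by (simp flip: sum_distrib_left)
qed

text \<open>
  With \<open>k D\<close> the number of upper or lower covers of \<open>v\<close> in \<open>D\<close>, this evaluates the row and column
  sums of a flow in terms of the coverage of \<open>v\<close>.
\<close>

lemma weighted_count_eq_coverage:
  fixes \<mu> :: "'a::{finite,order} set \<Rightarrow> real" and k :: "'a set \<Rightarrow> nat"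
  assumes "\<And>D. D \<notin> MaxChain \<Longrightarrow> \<mu> D = 0"
    and "\<And>D. D \<in> MaxChain \<Longrightarrow> v \<in> D \<Longrightarrow> k D = c"
  shows "(\<Sum>D | v \<in> D. \<mu> D * k D) = coverage \<mu> v * c"
  unfolding coverage_def sum_distrib_right
proof (rule sum.cong)
  fix D assume "D \<in> {D. v \<in> D}"
  with assms show "\<mu> D * k D = \<mu> D * c"
    by (cases "D \<in> MaxChain") auto
qed simp

text \<open>
  The combinatorial core: for complete stars and crowns, a weighting of maximal chains with the
  coverage of a weighting on \<open>\<C>\<close> must itself live on \<open>\<C>\<close>. A cover relation of \<open>D\<close> that \<open>\<C>\<close> does
  not use is a positive entry of the flow difference, and the alternating cycle through it is a
  guided crown whose completeness contradicts this.
\<close>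

lemma no_foreign_chain:
  fixes \<C> :: "'a::{finite,order} set set"
  assumes sub: "\<C> \<subseteq> MaxChain"
    and stars: "\<And>\<alpha>\<^sub>1 \<beta>\<^sub>1 \<alpha>\<^sub>2 \<beta>\<^sub>2. guided_star \<C> \<alpha>\<^sub>1 \<beta>\<^sub>1 \<alpha>\<^sub>2 \<beta>\<^sub>2 \<Longrightarrow> star_complete \<C> \<alpha>\<^sub>1 \<beta>\<^sub>1 \<alpha>\<^sub>2 \<beta>\<^sub>2"
    and crowns: "\<And>\<rho> \<alpha> \<beta>. guided_crown \<C> \<rho> \<alpha> \<beta> \<Longrightarrow> crown_complete \<C> \<rho> \<alpha> \<beta>"
    and l: "\<And>D. D \<notin> \<C> \<Longrightarrow> l D = 0"
    and \<mu>: "\<And>D. 0 \<le> \<mu> D" "\<And>D. D \<notin> MaxChain \<Longrightarrow> \<mu> D = (0::real)"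
    and cov: "\<And>v. coverage l v = coverage \<mu> v"
    and D: "0 < \<mu> D"
  shows "D \<in> \<C>"
proof (rule chain_of_used_covers_in_family[OF sub])
  show "(C \<inter> {..\<gamma>}) \<union> (E \<inter> {\<gamma><..}) \<in> \<C>" if "C \<in> \<C>" "\<gamma> \<in> C" "E \<in> \<C>" "\<gamma> \<in> E" for C E \<gamma>
    by (rule swap_in_family[OF sub stars that])
  show mc: "D \<in> MaxChain" using \<mu>(2)[of D] D by force
  show "D \<noteq> {}" using mc by (auto simp: MaxChain_iff)
  show "\<exists>C\<in>\<C>. v \<in> C" if "v \<in> D" for v
  proof -
    have "0 < coverage \<mu> v"
      unfolding coverage_def using D \<mu>(1) that by (intro sum_pos2[of _ D]) auto
    then have "coverage l v \<noteq> 0" by (simp add: cov)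
    then have "\<exists>C. v \<in> C \<and> l C \<noteq> 0"
      by (rule contrapos_np) (simp add: coverage_def sum.neutral)
    with l show ?thesis by blast
  qed
  show "chains_through \<C> v w \<noteq> {}" if vw: "v \<in> D" "w \<in> D" "v \<lessdot> w" for v w
  proof (rule ccontr)
    assume unused: "\<not> chains_through \<C> v w \<noteq> {}"
    have used: "x \<lessdot> y \<and> chains_through \<C> x y \<noteq> {}" if "cover_flow l x y \<noteq> 0" for x y
    proof -
      have "x \<lessdot> y" and "(\<Sum>D | x \<in> D \<and> y \<in> D. l D) \<noteq> 0"
        using that by (auto simp: cover_flow_def split: if_splits)
      moreover from this(2) have "\<exists>C. x \<in> C \<and> y \<in> C \<and> l C \<noteq> 0"
        by (rule contrapos_np) (simp add: sum.neutral)
      ultimately show ?thesis using l by (auto simp: chains_through_def)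
    qed
    define h where "h x y = cover_flow \<mu> x y - cover_flow l x y" for x y
    have l': "\<And>E. E \<notin> MaxChain \<Longrightarrow> l E = 0" using l sub by blast
    have "(\<Sum>y\<in>UNIV. h x y) = 0" for x
      unfolding h_def sum_subtractf cover_flow_row_sum
      using weighted_count_eq_coverage[where v=x and k="\<lambda>D. card {w \<in> D. x \<lessdot> w}", OF l' card_upper_covers_in_MaxChain]
        weighted_count_eq_coverage[where v=x and k="\<lambda>D. card {w \<in> D. x \<lessdot> w}", OF \<mu>(2) card_upper_covers_in_MaxChain]
      by (simp add: cov)
    moreover have "(\<Sum>x\<in>UNIV. h x y) = 0" for y
      unfolding h_def sum_subtractf cover_flow_column_sum
      using weighted_count_eq_coverage[where v=y and k="\<lambda>D. card {w \<in> D. w \<lessdot> y}", OF l' card_lower_covers_in_MaxChain]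
        weighted_count_eq_coverage[where v=y and k="\<lambda>D. card {w \<in> D. w \<lessdot> y}", OF \<mu>(2) card_lower_covers_in_MaxChain]
      by (simp add: cov)
    moreover have "0 < h v w"
    proof -
      have "0 < cover_flow \<mu> v w"
        unfolding cover_flow_def using D \<mu>(1) vw by (auto intro!: sum_pos2[of _ D])
      moreover have "cover_flow l v w = 0" using used unused by blast
      ultimately show ?thesis by (simp add: h_def)
    qed
    ultimately obtain n a b where n: "2 \<le> n" "alternating_walk h n a b"
      and ends: "a 0 = v" "b 0 = w" "b n = w" and inj: "inj_on a {..<n}" "inj_on b {1..n}"
      using alternating_cycle[of h v w] by blast
    have flow_nonneg: "0 \<le> cover_flow \<mu> x y" for x y
      by (auto simp: cover_flow_def intro!: sum_nonneg \<mu>(1))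
    have pos: "a i \<lessdot> b i" if "i < n" for i
    proof (rule ccontr)
      assume "\<not> ?thesis"
      then have "h (a i) (b i) = 0" by (simp add: h_def cover_flow_def)
      with n(2) that show False by (force simp: alternating_walk_def)
    qed
    have neg: "a i \<lessdot> b (Suc i) \<and> chains_through \<C> (a i) (b (Suc i)) \<noteq> {}" if "i < n" for i
    proof (rule used, rule notI)
      assume "cover_flow l (a i) (b (Suc i)) = 0"
      with n(2) that flow_nonneg[of "a i" "b (Suc i)"] show False
        by (force simp: alternating_walk_def h_def)
    qed
    \<comment> \<open>Crowns are indexed from 1, and \<open>\<alpha>\<^sub>i\<close> lies below \<open>\<beta>\<^sub>i\<close> and its predecessor, so only the rows shift.\<close>
    define \<alpha> where "\<alpha> i = a (i - 1)" for i
    have crown_pos: "\<alpha> i \<lessdot> b (cyc_pred n i)" if "i \<in> {1..n}" for i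
      using pos[of "i - 1"] that ends by (auto simp: \<alpha>_def cyc_pred_def)
    have crown_neg: "\<alpha> i \<lessdot> b i \<and> chains_through \<C> (\<alpha> i) (b i) \<noteq> {}" if "i \<in> {1..n}" for i
      using neg[of "i - 1"] that by (cases i) (simp_all add: \<alpha>_def)
    have "\<alpha> i \<noteq> \<alpha> j \<and> b i \<noteq> b j" if "i \<in> {1..n}" "j \<in> {1..n}" "i \<noteq> j" for i j
    proof -
      have "i - 1 \<in> {..<n}" "j - 1 \<in> {..<n}" "i - 1 \<noteq> j - 1" using that by auto
      then show ?thesis
        using that inj_onD[OF inj(1)] inj_onD[OF inj(2)] unfolding \<alpha>_def by blast
    qed
    then have "guided_crown \<C> n \<alpha> b"
      unfolding guided_crown_def using n(1) crown_pos crown_neg by blast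
    then have comp: "crown_complete \<C> n \<alpha> b" by (rule crowns)
    \<comment> \<open>At index 1 the predecessor is \<open>n\<close>, so completeness there glues along \<open>v \<lessdot> w\<close>.\<close>
    have n1: "1 \<in> {1..n}" "n \<in> {1..n}" "cyc_pred n 1 = n" "\<alpha> 1 = v"
      using n(1) ends by (auto simp: cyc_pred_def \<alpha>_def)
    obtain C C' where C: "C \<in> chains_through \<C> v (b 1)" "C' \<in> chains_through \<C> (\<alpha> n) w"
      using crown_neg[of 1] crown_neg[of n] n1 ends by auto
    have "(C \<inter> {..v}) \<union> (C' \<inter> {w..}) \<in> \<C>"
      using bspec[OF comp[unfolded crown_complete_def] n1(1)] C unfolding n1(3,4) ends(3) by blast
    then have "(C \<inter> {..v}) \<union> (C' \<inter> {w..}) \<in> chains_through \<C> v w"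
      using C by (auto simp: chains_through_def)
    with unused show False by blast
  qed
qed

section \<open>Hulls of indicator vectors and their faces\<close>

lemma unit_sum_nth: "unit_sum Q $ v = of_bool (v \<in> Q)"
  by (simp add: unit_sum_def axis_def if_distrib cong: if_cong)

lemma inj_unit_sum: "inj unit_sum"
  by (rule injI) (simp add: vec_eq_iff unit_sum_nth set_eq_iff of_bool_eq_iff)

definition conv_weights :: "'a::finite set set \<Rightarrow> ('a set \<Rightarrow> real) \<Rightarrow> real ^ 'a \<Rightarrow> bool"
  where "conv_weights \<Q> \<mu> x \<longleftrightarrow>
    (\<forall>D. 0 \<le> \<mu> D) \<and> (\<forall>D. D \<notin> \<Q> \<longrightarrow> \<mu> D = 0) \<and> sum \<mu> UNIV = 1 \<and> (\<forall>v. x $ v = coverage \<mu> v)"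

lemma in_conv_iff_weights: "x \<in> conv \<Q> \<longleftrightarrow> (\<exists>\<mu>. conv_weights \<Q> \<mu> x)"
proof
  assume "x \<in> conv \<Q>"
  then obtain u where u: "\<forall>y\<in>unit_sum ` \<Q>. 0 \<le> u y" "sum u (unit_sum ` \<Q>) = 1"
      "(\<Sum>y\<in>unit_sum ` \<Q>. u y *\<^sub>R y) = x"
    unfolding conv_def by (subst (asm) convex_hull_finite) auto
  define \<mu> where "\<mu> D = (if D \<in> \<Q> then u (unit_sum D) else 0)" for D
  have inj: "inj_on unit_sum \<Q>" using inj_unit_sum by (rule inj_on_subset) simp
  have "x $ v = coverage \<mu> v" for v
  proof -
    have "x $ v = (\<Sum>D\<in>\<Q>. u (unit_sum D) * of_bool (v \<in> D))"
      unfolding u(3)[symmetric] by (simp add: sum.reindex[OF inj] unit_sum_nth)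
    also have "\<dots> = coverage \<mu> v"
      unfolding coverage_def by (rule sum.mono_neutral_cong) (auto simp: \<mu>_def)
    finally show ?thesis .
  qed
  moreover have "sum \<mu> UNIV = 1"
    using u(2) by (simp add: sum.reindex[OF inj] \<mu>_def sum.If_cases)
  ultimately show "\<exists>\<mu>. conv_weights \<Q> \<mu> x"
    using u(1) by (auto simp: conv_weights_def \<mu>_def intro!: exI[of _ \<mu>])
next
  assume "\<exists>\<mu>. conv_weights \<Q> \<mu> x"
  then obtain \<mu> where \<mu>: "\<And>D. 0 \<le> \<mu> D" "\<And>D. D \<notin> \<Q> \<Longrightarrow> \<mu> D = 0" "sum \<mu> UNIV = 1"
      "\<And>v. x $ v = coverage \<mu> v" by (auto simp: conv_weights_def)
  have supp: "D \<in> \<Q>" if "\<mu> D \<noteq> 0" for D using \<mu>(2) that by blast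
  have "x = (\<Sum>D\<in>\<Q>. \<mu> D *\<^sub>R unit_sum D)"
    unfolding vec_eq_iff \<mu>(4) coverage_def
    by (auto simp: unit_sum_nth intro!: sum.mono_neutral_cong intro: supp)
  moreover have "sum \<mu> \<Q> = 1"
    using \<mu>(3) sum.mono_neutral_left[of UNIV \<Q> \<mu>] \<mu>(2) by simp
  moreover have "(\<Sum>D\<in>\<Q>. \<mu> D *\<^sub>R unit_sum D) \<in> convex hull (unit_sum ` \<Q>)" if "sum \<mu> \<Q> = 1"
    by (rule convex_sum) (auto simp: that \<mu>(1) hull_inc)
  ultimately show "x \<in> conv \<Q>" by (simp add: conv_def)
qed

text \<open>
  Indicator vectors have entries \<open>0\<close> and \<open>1\<close>, the extreme values of a coverage of total weight
  \<open>1\<close>. So every set of positive weight contains all of \<open>D\<close> and nothing else.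
\<close>

lemma unit_sum_in_conv_iff: "unit_sum D \<in> conv \<Q> \<longleftrightarrow> D \<in> \<Q>"
proof
  assume "unit_sum D \<in> conv \<Q>"
  then obtain \<mu> where \<mu>: "\<And>E. 0 \<le> \<mu> E" "\<And>E. E \<notin> \<Q> \<Longrightarrow> \<mu> E = 0" "sum \<mu> UNIV = 1"
      "\<And>v. of_bool (v \<in> D) = coverage \<mu> v"
    by (auto simp: in_conv_iff_weights conv_weights_def unit_sum_nth)
  obtain C where C: "\<mu> C \<noteq> 0" using \<mu>(3) by (metis sum.neutral zero_neq_one)
  with \<mu>(1)[of C] have Cpos: "0 < \<mu> C" by simp
  have "v \<in> C \<longleftrightarrow> v \<in> D" for v
  proof
    assume "v \<in> C"
    then have "0 < coverage \<mu> v"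
      unfolding coverage_def using Cpos \<mu>(1) by (intro sum_pos2[of _ C]) auto
    then show "v \<in> D" using \<mu>(4)[of v] by (cases "v \<in> D") auto
  next
    assume "v \<in> D"
    then have "(\<Sum>E | v \<in> E. \<mu> E) = 1" using \<mu>(4)[of v] by (simp add: coverage_def)
    moreover have "sum \<mu> UNIV = (\<Sum>E | v \<in> E. \<mu> E) + (\<Sum>E | v \<notin> E. \<mu> E)"
      by (subst sum.union_disjoint[symmetric]) (auto intro!: sum.cong)
    ultimately have "(\<Sum>E | v \<notin> E. \<mu> E) = 0" using \<mu>(3) by simp
    then have "\<forall>E\<in>{E. v \<notin> E}. \<mu> E = 0"
      using \<mu>(1) by (subst (asm) sum_nonneg_eq_0_iff) auto
    with C show "v \<in> C" by auto
  qed
  then have "C = D" by blast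
  then show "D \<in> \<Q>" using C \<mu>(2) by blast
next
  show "D \<in> \<Q> \<Longrightarrow> unit_sum D \<in> conv \<Q>" by (simp add: conv_def hull_inc)
qed

text \<open>
  Divided by the number of summands, the common sum is a point of \<open>T\<close> that lies between \<open>d j\<close> and
  the average of the other \<open>d i\<close>.
\<close>

lemma face_of_sum_eq:
  fixes S T :: "'v::real_vector set"
  assumes face: "T face_of S" and S: "convex S" and I: "finite I"
    and c: "\<And>i. i \<in> I \<Longrightarrow> c i \<in> T" and d: "\<And>i. i \<in> I \<Longrightarrow> d i \<in> S"
    and eq: "sum c I = sum d I" and j: "j \<in> I"
  shows "d j \<in> T"
proof (cases "I = {j}")
  case True
  then show ?thesis using eq c by simp
next
  case False
  define n where "n = real (card I)"
  define y where "y = (\<Sum>i\<in>I-{j}. (1 / (n - 1)) *\<^sub>R d i)"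
  have "card I \<noteq> 1" using False j by (auto simp: card_1_singleton_iff)
  moreover have "0 < card I" using I j by (auto simp: card_gt_0_iff)
  ultimately have n: "1 < n" by (simp add: n_def)
  have "convex T" using face by (rule face_of_imp_convex)
  then have "(\<Sum>i\<in>I. (1 / n) *\<^sub>R c i) \<in> T"
    using I c n by (intro convex_sum) (auto simp: n_def)
  also have "(\<Sum>i\<in>I. (1 / n) *\<^sub>R c i) = (1 / n) *\<^sub>R (d j + (\<Sum>i\<in>I-{j}. d i))"
    using eq sum.remove[OF I j, of d] by (simp flip: scaleR_sum_right)
  also have "\<dots> = (1 - (1 - 1 / n)) *\<^sub>R d j + (1 - 1 / n) *\<^sub>R y"
    using n by (simp add: y_def scaleR_right_distrib field_simps flip: scaleR_sum_right)
  finally have x: "(1 - (1 - 1 / n)) *\<^sub>R d j + (1 - 1 / n) *\<^sub>R y \<in> T" .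
  have weights: "(\<Sum>i\<in>I-{j}. 1 / (n - 1)) = 1"
    using n j I by (simp add: n_def of_nat_diff)
  have y: "y \<in> S"
    unfolding y_def using I d n by (intro convex_sum[OF _ S weights]) auto
  show ?thesis
  proof (cases "d j = y")
    case True
    with x show ?thesis by (simp flip: scaleR_left_distrib)
  next
    case False
    with n have "(1 - (1 - 1 / n)) *\<^sub>R d j + (1 - 1 / n) *\<^sub>R y \<in> open_segment (d j) y"
      unfolding in_segment by (intro conjI exI[of _ "1 - 1 / n"]) auto
    with face_ofD[OF face _ d[OF j] y x] show ?thesis by blast
  qed
qed

lemma face_of_chain_exchange:
  fixes \<C> :: "'a::{finite,order} set set"
  assumes face: "conv \<C> face_of max_chain_polytope" and "finite I"
    and "\<And>i. i \<in> I \<Longrightarrow> C i \<in> \<C>" and "\<And>i. i \<in> I \<Longrightarrow> D i \<in> MaxChain"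
    and eq: "\<And>v. (\<Sum>i\<in>I. of_bool (v \<in> C i)) = (\<Sum>i\<in>I. of_bool (v \<in> D i) :: real)" and "j \<in> I"
  shows "D j \<in> \<C>"
proof -
  have "(\<Sum>i\<in>I. unit_sum (C i)) = (\<Sum>i\<in>I. unit_sum (D i))"
    by (simp add: vec_eq_iff unit_sum_nth eq del: sum_of_bool_eq)
  then have "unit_sum (D j) \<in> conv \<C>"
    using face_of_sum_eq[OF face, of I "\<lambda>i. unit_sum (C i)" "\<lambda>i. unit_sum (D i)" j] assms
    by (simp add: max_chain_polytope_def unit_sum_in_conv_iff) (simp add: conv_def)
  then show ?thesis by (simp add: unit_sum_in_conv_iff)
qed

section \<open>Completeness of stars and crowns as a face condition\<close>

lemma star_complete_if_face:
  fixes \<C> :: "'a::{finite,order} set set"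
  assumes sub: "\<C> \<subseteq> MaxChain" and face: "conv \<C> face_of max_chain_polytope"
  shows "star_complete \<C> \<alpha>\<^sub>1 \<beta>\<^sub>1 \<alpha>\<^sub>2 \<beta>\<^sub>2"
proof -
  have "(C\<^sub>1 \<inter> {..\<gamma>}) \<union> (C\<^sub>2 \<inter> {\<gamma><..}) \<in> \<C>"
    if C: "C\<^sub>1 \<in> \<C>" "C\<^sub>2 \<in> \<C>" "\<gamma> \<in> C\<^sub>1" "\<gamma> \<in> C\<^sub>2" for C\<^sub>1 C\<^sub>2 \<gamma>
  proof -
    define D where "D b = (if b then (C\<^sub>1 \<inter> {..\<gamma>}) \<union> (C\<^sub>2 \<inter> {\<gamma><..}) else (C\<^sub>2 \<inter> {..\<gamma>}) \<union> (C\<^sub>1 \<inter> {\<gamma><..}))" for b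
    have mc: "C\<^sub>1 \<in> MaxChain" "C\<^sub>2 \<in> MaxChain" using C sub by auto
    have "D True \<in> \<C>"
    proof (rule face_of_chain_exchange[OF face, of UNIV "\<lambda>b. if b then C\<^sub>1 else C\<^sub>2"])
      show "D b \<in> MaxChain" for b 
      using MaxChain_swap[OF mc C(3,4)] MaxChain_swap[OF mc(2,1) C(4,3)] by (simp add: D_def)
      show "(\<Sum>b\<in>UNIV. of_bool (v \<in> (if b then C\<^sub>1 else C\<^sub>2))) = (\<Sum>b\<in>UNIV. of_bool (v \<in> D b) :: real)" for v
        using MaxChain_chain[OF mc(1) _ C(3), of v] MaxChain_chain[OF mc(2) _ C(4), of v]
        by (auto simp: UNIV_bool D_def le_less simp del: sum_of_bool_eq)
    qed (use C in auto)
    then show ?thesis by (simp add: D_def)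
  qed
  then show ?thesis by (auto simp: star_complete_def chains_through_def)
qed

lemma bij_betw_cyc_pred: "1 \<le> \<rho> \<Longrightarrow> bij_betw (cyc_pred \<rho>) {1..\<rho>} {1..\<rho>}"
  by (rule bij_betwI[where g = "\<lambda>i. if i = \<rho> then 1 else i + 1"]) (auto simp: cyc_pred_def)

text \<open>
  Since $\alpha_i \lessdot \beta_i$, a chain through both is its part up to $\alpha_i$ together with
  its part from $\beta_i$ on. Rerouting along $\alpha_i \lessdot \beta_{i-1}$ only pairs these parts
  in a different way, so the sum over the whole crown does not change.
\<close>

lemma crown_complete_if_face:
  fixes \<C> :: "'a::{finite,order} set set"
  assumes sub: "\<C> \<subseteq> MaxChain" and face: "conv \<C> face_of max_chain_polytope"
    and crown: "guided_crown \<C> \<rho> \<alpha> \<beta>"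
  shows "crown_complete \<C> \<rho> \<alpha> \<beta>"
  unfolding crown_complete_def
proof (intro ballI)
  fix j C C'
  assume j: "j \<in> {1..\<rho>}" and C: "C \<in> chains_through \<C> (\<alpha> j) (\<beta> j)"
    and C': "C' \<in> chains_through \<C> (\<alpha> (cyc_pred \<rho> j)) (\<beta> (cyc_pred \<rho> j))"
  let ?p = "cyc_pred \<rho>"
  have \<rho>: "2 \<le> \<rho>" and cov: "\<And>i. i \<in> {1..\<rho>} \<Longrightarrow> \<alpha> i \<lessdot> \<beta> i \<and> \<alpha> i \<lessdot> \<beta> (?p i)"
    and ne: "\<forall>i\<in>{1..\<rho>}. \<exists>E. E \<in> chains_through \<C> (\<alpha> i) (\<beta> i)"
    using crown by (auto simp: guided_crown_def)
  from ne obtain K where K: "\<And>i. i \<in> {1..\<rho>} \<Longrightarrow> K i \<in> chains_through \<C> (\<alpha> i) (\<beta> i)"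
    by metis
  \<comment> \<open>The two chains under test sit at \<open>j\<close> and its predecessor; elsewhere any guiding chain will do.\<close>
  define E where "E = K(j := C, ?p j := C')"
  have pj: "?p j \<noteq> j" using \<rho> j by (auto simp: cyc_pred_def)
  have bij: "bij_betw ?p {1..\<rho>} {1..\<rho>}" using \<rho> by (intro bij_betw_cyc_pred) simp
  then have p: "?p i \<in> {1..\<rho>}" if "i \<in> {1..\<rho>}" for i using that by (auto simp: bij_betw_def)
  have E: "E i \<in> \<C>" "\<alpha> i \<in> E i" "\<beta> i \<in> E i" if "i \<in> {1..\<rho>}" for i
    using K[OF that] C C' by (auto simp: E_def chains_through_def)
  let ?lo = "\<lambda>i v. of_bool (v \<in> E i \<and> v \<le> \<alpha> i) :: real"
  let ?hi = "\<lambda>i v. of_bool (v \<in> E i \<and> \<beta> i \<le> v) :: real"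
  define D where "D i = (E i \<inter> {..\<alpha> i}) \<union> (E (?p i) \<inter> {\<beta> (?p i)..})" for i
  have split_E: "of_bool (v \<in> E i) = ?lo i v + ?hi i v" if i: "i \<in> {1..\<rho>}" for i v
  proof -
    have mc: "E i \<in> MaxChain" using E i sub by blast
    have "v \<le> \<alpha> i \<or> \<beta> i \<le> v" if "v \<in> E i"
      using MaxChain_chain[OF mc that E(2)[OF i]] MaxChain_chain[OF mc that E(3)[OF i]] cov[OF i]
      by (metis covered_by_def order_le_less)
    moreover have "\<not> (v \<le> \<alpha> i \<and> \<beta> i \<le> v)"
      using cov[OF i] by (metis covered_by_def leD order_trans)
    ultimately show ?thesis by auto
  qed
  have split_D: "of_bool (v \<in> D i) = ?lo i v + ?hi (?p i) v" if i: "i \<in> {1..\<rho>}" for i v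
  proof -
    have "\<not> (v \<le> \<alpha> i \<and> \<beta> (?p i) \<le> v)"
      using cov[OF i] by (metis covered_by_def leD order_trans)
    then show ?thesis by (auto simp: D_def)
  qed
  have "D j \<in> \<C>"
  proof (rule face_of_chain_exchange[OF face, of "{1..\<rho>}" E])
    show "D i \<in> MaxChain" if "i \<in> {1..\<rho>}" for i
      unfolding D_def using E[OF that] E[OF p[OF that]] cov[OF that] sub
      by (intro MaxChain_glue) auto
    fix v
    have "(\<Sum>i\<in>{1..\<rho>}. of_bool (v \<in> E i)) = (\<Sum>i\<in>{1..\<rho>}. ?lo i v) + (\<Sum>i\<in>{1..\<rho>}. ?hi i v)"
      unfolding sum.distrib[symmetric] by (intro sum.cong split_E refl)
    also have "(\<Sum>i\<in>{1..\<rho>}. ?hi i v) = (\<Sum>i\<in>{1..\<rho>}. ?hi (?p i) v)"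
      using sum.reindex_bij_betw[OF bij, of "\<lambda>i. ?hi i v"] by (rule sym)
    also have "(\<Sum>i\<in>{1..\<rho>}. ?lo i v) + \<dots> = (\<Sum>i\<in>{1..\<rho>}. of_bool (v \<in> D i))"
      unfolding sum.distrib[symmetric] by (intro sum.cong split_D[symmetric] refl)
    finally show "(\<Sum>i\<in>{1..\<rho>}. of_bool (v \<in> E i)) = (\<Sum>i\<in>{1..\<rho>}. of_bool (v \<in> D i) :: real)" .
  qed (use E j in auto)
  then show "(C \<inter> {..\<alpha> j}) \<union> (C' \<inter> {\<beta> (?p j)..}) \<in> \<C>"
    using pj by (simp add: D_def E_def)
qed

text \<open>
  If a point of the hull of \<open>\<C>\<close> lies inside a segment, mixing weights of the two endpoints gives
  another weighting of that point. Both mixing coefficients are positive, so a chain that has positive weight at an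
  endpoint has positive weight in the mixture, and \<open>no_foreign_chain\<close> applies.
\<close>

lemma face_if_complete:
  fixes \<C> :: "'a::{finite,order} set set"
  assumes sub: "\<C> \<subseteq> MaxChain"
    and stars: "\<And>\<alpha>\<^sub>1 \<beta>\<^sub>1 \<alpha>\<^sub>2 \<beta>\<^sub>2. guided_star \<C> \<alpha>\<^sub>1 \<beta>\<^sub>1 \<alpha>\<^sub>2 \<beta>\<^sub>2 \<Longrightarrow> star_complete \<C> \<alpha>\<^sub>1 \<beta>\<^sub>1 \<alpha>\<^sub>2 \<beta>\<^sub>2"
    and crowns: "\<And>\<rho> \<alpha> \<beta>. guided_crown \<C> \<rho> \<alpha> \<beta> \<Longrightarrow> crown_complete \<C> \<rho> \<alpha> \<beta>"
  shows "conv \<C> face_of max_chain_polytope"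
  unfolding face_of_def
proof (intro conjI ballI impI)
  show "conv \<C> \<subseteq> max_chain_polytope"
    using sub by (auto simp: conv_def max_chain_polytope_def intro!: hull_mono)
  show "convex (conv \<C>)" by (simp add: conv_def)
  fix x y z
  assume "x \<in> max_chain_polytope" "y \<in> max_chain_polytope" "z \<in> conv \<C>" and seg: "z \<in> open_segment x y"
  then obtain \<mu> \<nu> l where \<mu>: "conv_weights MaxChain \<mu> x" and \<nu>: "conv_weights MaxChain \<nu> y"
    and l: "conv_weights \<C> l z"
    by (auto simp: max_chain_polytope_def in_conv_iff_weights)
  obtain u where u: "0 < u" "u < 1" "z = (1 - u) *\<^sub>R x + u *\<^sub>R y"
    using seg by (auto simp: in_segment)
  define \<kappa> where "\<kappa> D = (1 - u) * \<mu> D + u * \<nu> D" for D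
  have "coverage l v = coverage \<kappa> v" for v
  proof -
    have "coverage l v = (1 - u) * coverage \<mu> v + u * coverage \<nu> v"
      using l \<mu> \<nu> by (simp add: conv_weights_def u(3))
    then show ?thesis
      by (simp add: coverage_def \<kappa>_def sum.distrib sum_distrib_left)
  qed
  then have supp: "D \<in> \<C>" if "0 < \<kappa> D" for D
    using no_foreign_chain[OF sub stars crowns, of l \<kappa> D] that l \<mu> \<nu> u
    by (auto simp: conv_weights_def \<kappa>_def)
  have nonneg: "0 \<le> \<mu> D" "0 \<le> \<nu> D" for D using \<mu> \<nu> by (auto simp: conv_weights_def)
  have "\<mu> D = 0 \<and> \<nu> D = 0" if "D \<notin> \<C>" for D
  proof -
    have "\<not> 0 < \<kappa> D" using supp that by blast
    moreover have "0 \<le> (1 - u) * \<mu> D" "0 \<le> u * \<nu> D" using nonneg u by auto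
    ultimately have "(1 - u) * \<mu> D = 0" "u * \<nu> D = 0" unfolding \<kappa>_def by linarith+
    with u show ?thesis by auto
  qed
  then have "conv_weights \<C> \<mu> x" "conv_weights \<C> \<nu> y"
    using \<mu> \<nu> by (auto simp: conv_weights_def)
  then show "x \<in> conv \<C>" "y \<in> conv \<C>" by (auto simp: in_conv_iff_weights)
qed

theorem theorem2p12:
  fixes \<C> :: "'a::{finite,order} set set"
  assumes "\<C> \<subseteq> MaxChain" and "\<C> \<noteq> {}"
  shows "\<not> (conv \<C> face_of max_chain_polytope) \<longleftrightarrow> has_incomplete_guided_crown_structure \<C>"
proof
  assume not_face: "\<not> (conv \<C> face_of max_chain_polytope)"
  show "has_incomplete_guided_crown_structure \<C>"
  proof (rule ccontr)
    assume "\<not> has_incomplete_guided_crown_structure \<C>"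
    then have "star_complete \<C> \<alpha>\<^sub>1 \<beta>\<^sub>1 \<alpha>\<^sub>2 \<beta>\<^sub>2" if "guided_star \<C> \<alpha>\<^sub>1 \<beta>\<^sub>1 \<alpha>\<^sub>2 \<beta>\<^sub>2" for \<alpha>\<^sub>1 \<beta>\<^sub>1 \<alpha>\<^sub>2 \<beta>\<^sub>2
      using that unfolding has_incomplete_guided_crown_structure_def has_guided_crown_structure_def by blast
    moreover have "crown_complete \<C> \<rho> \<alpha> \<beta>" if "guided_crown \<C> \<rho> \<alpha> \<beta>" for \<rho> \<alpha> \<beta>
      using that \<open>\<not> has_incomplete_guided_crown_structure \<C>\<close>
      unfolding has_incomplete_guided_crown_structure_def has_guided_crown_structure_def by blast
    ultimately have "conv \<C> face_of max_chain_polytope"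
      by (rule face_if_complete[OF assms(1)])
    with not_face show False ..
  qed
next
  assume "has_incomplete_guided_crown_structure \<C>"
  then show "\<not> (conv \<C> face_of max_chain_polytope)"
    using star_complete_if_face[OF assms(1)] crown_complete_if_face[OF assms(1)]
    unfolding has_incomplete_guided_crown_structure_def by blast
qed

end
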